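(* The space $\mathcal{J}_3(\mathbb{F}_2)$ is a primitive subspace of $\mathrm{M}_3(\mathbb{F}_2)$ with upper rank $2$. A linear subspace of $\mathcal{J}_3(\mathbb{F}_2)$ is primitive with upper rank $2$ if and only if, for all $(a,b)\in(\mathbb{F}_2)^2$, it contains at least one matrix of the form $$\begin{bmatrix} a & ? & ?\\ 0 & a+b & ?\\ 0&0&b\end{bmatrix},$$ where the question marks stand for unspecified entries in $\mathbb{F}_2$.
   Context: $\mathrm{M}_{n,p}(\mathbb{K})$ is the space of $n\times p$ matrices over a field $\mathbb{K}$, and $\mathrm{M}_n(\mathbb{K})=\mathrm{M}_{n,n}(\mathbb{K})$. The upper rank $\operatorname{urk}(\mathcal{V})$ of a linear subspace $\mathcal{V}$ of $\mathrm{M}_{n,p}(\mathbb{K})$ is the maximal rank of a matrix in $\mathcal{V}$. Two linear subspaces $\mathcal{V}_1,\mathcal{V}_2$ of $\mathrm{M}_{n,p}(\mathbb{K})$ are equivalent when $\mathcal{V}_2=P\mathcal{V}_1Q$ for some $P\in\mathrm{GL}_n(\mathbb{K})$, $Q\in\mathrm{GL}_p(\mathbb{K})$. A linear subspace $\mathcal{V}$ of $\mathrm{M}_{n,p}(\mathbb{K})$ with upper rank $r$ is called primitive when: (i) no non-zero vector of $\mathbb{K}^p$ belongs to the kernel of every matrix of $\mathcal{V}$; (ii) the span of the ranges of all the matrices of $\mathcal{V}$ is $\mathbb{K}^n$; (iii) $\mathcal{V}$ is not equivalent to a space $\mathcal{T}$ of matrices of the form $M=\begin{bmatrix} H(M)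 & [?]_{n\times 1}\end{bmatrix}$ (so $H(M)\in\mathrm{M}_{n,p-1}(\mathbb{K})$) where $\operatorname{urk}H(\mathcal{T})\leq r-1$; (iv) $\mathcal{V}$ is not equivalent to a space $\mathcal{T}$ of matrices of the form $M=\begin{bmatrix} H(M)\\ [?]_{1\times p}\end{bmatrix}$ (so $H(M)\in\mathrm{M}_{n-1,p}(\mathbb{K})$) where $\operatorname{urk}H(\mathcal{T})\leq r-1$. $\mathcal{J}_3(\mathbb{F}_2)$ is the space of all upper-triangular $3\times 3$ matrices over $\mathbb{F}_2$ with trace zero, i.e. $$\mathcal{J}_3(\mathbb{F}_2)=\left\{\begin{bmatrix}a&c&d\\0&a+b&e\\0&0&b\end{bmatrix}\mid (a,b,c,d,e)\in\mathbb{F}_2^5\right\}.$$ *)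

theory Defs
  imports "Jordan_Normal_Form.DL_Rank" "Jordan_Normal_Form.Matrix_Kernel" "HOL-Library.Z2"
begin

definition linear_subspace :: "nat \<Rightarrow> nat \<Rightarrow> 'a::field mat set \<Rightarrow> bool" where
  "linear_subspace n p V \<longleftrightarrow> subspace class_ring V (module_mat TYPE('a) n p)"

text \<open>
  On a nonempty set of matrices with \<open>n\<close> rows the ranks are bounded by \<open>n\<close>, so the maximum is
  attained. The column number plays no role in the library's rank, which is that of the span of the
  columns in \<open>K\<^sup>n\<close>.
\<close>

definition urk :: "nat \<Rightarrow> 'a::field mat set \<Rightarrow> nat" where
  "urk n V = Max (vec_space.rank n ` V)"

definition equivalent_spaces :: "nat \<Rightarrow> nat \<Rightarrow> 'a::field mat set \<Rightarrow> 'a mat set \<Rightarrow> bool" where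
  "equivalent_spaces n p V W \<longleftrightarrow>
     (\<exists>P \<in> carrier_mat n n. \<exists>Q \<in> carrier_mat p p.
        invertible_mat P \<and> invertible_mat Q \<and> W = (\<lambda>M. P * M * Q) ` V)"

definition mat_range :: "'a::field mat \<Rightarrow> 'a vec set" where
  "mat_range M = (\<lambda>x. M *\<^sub>v x) ` carrier_vec (dim_col M)"

definition del_last_col :: "'a mat \<Rightarrow> 'a mat" where
  "del_last_col M = mat (dim_row M) (dim_col M - 1) (\<lambda>(i, j). M $$ (i, j))"

definition del_last_row :: "'a mat \<Rightarrow> 'a mat" where
  "del_last_row M = mat (dim_row M - 1) (dim_col M) (\<lambda>(i, j). M $$ (i, j))"

text \<open>
  In a block decomposition \<open>[H(M) | C]\<close> with a single column \<open>C\<close>, the block \<open>H(M)\<close> is \<open>M\<close> without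
  its last column, and likewise for rows. The bound \<open>urk H(T) \<le> r - 1\<close> is written \<open>urk H(T) < r\<close>,
  which avoids truncated subtraction for \<open>r = 0\<close>. No separate treatment of \<open>p = 0\<close> or \<open>n = 0\<close> is
  needed, because then \<open>r = 0\<close> and the last two conditions hold, no such block form being possible.
\<close>

definition primitive_space :: "nat \<Rightarrow> nat \<Rightarrow> 'a::field mat set \<Rightarrow> bool" where
  "primitive_space n p V \<longleftrightarrow>
     linear_subspace n p V \<and>
     (\<nexists>x. x \<in> carrier_vec p \<and> x \<noteq> 0\<^sub>v p \<and> (\<forall>M \<in> V. x \<in> mat_kernel M)) \<and>
     LinearCombinations.module.span class_ring (module_vec TYPE('a) n) (\<Union>M \<in> V. mat_range M)
       = carrier_vec n \<and>
     (\<nexists>T. equivalent_spaces n p V T \<and> urk n (del_last_col ` T) < urk n V) \<and>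
     (\<nexists>T. equivalent_spaces n p V T \<and> urk (n - 1) (del_last_row ` T) < urk n V)"

definition tri_mat :: "bit \<Rightarrow> bit \<Rightarrow> bit \<Rightarrow> bit \<Rightarrow> bit \<Rightarrow> bit mat" where
  "tri_mat a b c d e = mat_of_rows_list 3 [[a, c, d], [0, a + b, e], [0, 0, b]]"

definition J3 :: "bit mat set" where
  "J3 = {tri_mat a b c d e | a b c d e. True}"

lemma J3_eq_upper_triangular_trace_0:
  "J3 = {M \<in> carrier_mat 3 3. upper_triangular M \<and> sum_list (diag_mat M) = 0}"
proof (intro equalityI subsetI)
  fix M :: "bit mat"
  assume "M \<in> J3"
  then show "M \<in> {M \<in> carrier_mat 3 3. upper_triangular M \<and> sum_list (diag_mat M) = 0}"
    by (auto simp: J3_def tri_mat_def mat_of_rows_list_def upper_triangular_def diag_mat_def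
        less_Suc_eq numeral_3_eq_3)
next
  fix M :: "bit mat"
  assume "M \<in> {M \<in> carrier_mat 3 3. upper_triangular M \<and> sum_list (diag_mat M) = 0}"
  then have M: "M \<in> carrier_mat 3 3" and ut: "upper_triangular M"
    and tr: "M $$ (0, 0) + M $$ (1, 1) + M $$ (2, 2) = 0"
    by (auto simp: diag_mat_def numeral_3_eq_3 numeral_2_eq_2 add.assoc)
  have mid: "M $$ (1, 1) = M $$ (0, 0) + M $$ (2, 2)"
    using tr by (cases "M $$ (0, 0)"; cases "M $$ (1, 1)"; cases "M $$ (2, 2)") auto
  have "M = tri_mat (M $$ (0, 0)) (M $$ (2, 2)) (M $$ (0, 1)) (M $$ (0, 2)) (M $$ (1, 2))"
    using M ut mid
    by (intro eq_matI)
      (auto simp: tri_mat_def mat_of_rows_list_def upper_triangular_def less_Suc_eq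
        numeral_3_eq_3 numeral_2_eq_2)
  then show "M \<in> J3"
    unfolding J3_def by blast
qed

end

theory Submission
  imports Defs
begin

text \<open>
  For \<open>n \<ge> 2\<close>, an \<open>n \<times> n\<close> space \<open>V\<close> of upper rank at most \<open>n - 1\<close> is primitive if every hyperplane
  of \<open>K\<^sup>n\<close> meets the kernel of some member of \<open>V\<close> trivially, and the same holds for the
  transposes. Indeed, deleting the last column of \<open>P M Q\<close> amounts, up to changes of basis, to
  restricting \<open>M\<close> to the hyperplane spanned by the first \<open>n - 1\<close> columns of \<open>Q\<close>; injectivity there
  means rank \<open>n - 1\<close>, so the upper rank does not drop. A common kernel vector is excluded because
  it lies in some hyperplane. The conditions on rows and ranges are the transposed ones. This is
  \<open>primitive_space_if_hyperplane_injective\<close>.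

  A matrix of \<open>J3\<close> has determinant \<open>a (a + b) b\<close>, which vanishes on \<open>F\<^sub>2\<close>, so all ranks are at most
  \<open>2\<close>. If a subspace \<open>W\<close> contains matrices with all the diagonals \<open>(0, 1, 1)\<close>, \<open>(1, 0, 1)\<close> and
  \<open>(1, 1, 0)\<close>, then their kernels are the lines spanned by vectors \<open>(1, 0, 0)\<close>, \<open>(?, 1, 0)\<close> and
  \<open>(?, ?, 1)\<close>. These three vectors are linearly independent, hence each plane misses one of the
  three lines. The same happens for the left kernels, and the criterion applies.

  Conversely, the diagonals \<open>(a, b)\<close> that occur in \<open>W\<close> form a subspace of \<open>F\<^sub>2\<^sup>2\<close>. If it is proper, it
  is contained in one of the three lines \<open>a = 0\<close>, \<open>b = 0\<close>, \<open>a = b\<close>. In the first case the first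
  column of all matrices is zero, in the second the last row is, and in the third the first two
  columns have no nonzero entry outside the first row, so that deleting the last column leaves
  rank at most \<open>1\<close>. Each contradicts primitivity with upper rank \<open>2\<close>.
\<close>

section \<open>Rank and triviality of the kernels\<close>

lemma in_span_annihilated:
  fixes y :: "'a::field vec"
  assumes S: "S \<subseteq> carrier_vec n" and y: "y \<in> carrier_vec n"
    and ann: "\<And>s. s \<in> S \<Longrightarrow> s \<bullet> y = 0"
    and v: "v \<in> LinearCombinations.module.span class_ring (module_vec TYPE('a) n) S"
  shows "v \<bullet> y = 0"
proof -
  interpret vec_space "TYPE('a)" n .
  have "submodule class_ring {w \<in> carrier_vec n. w \<bullet> y = 0} V"
    using y by unfold_locales
      (auto simp: module_vec_simps class_ring_simps add_scalar_prod_distrib[where n = n])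
  then have "span S \<subseteq> {w \<in> carrier_vec n. w \<bullet> y = 0}"
    using S ann by (intro span_is_subset) auto
  then show ?thesis
    using v by blast
qed

text \<open>
  A maximal linearly independent subset \<open>B\<close> of \<open>S\<close> spans \<open>S\<close>. If \<open>B\<close> had fewer than \<open>n\<close> elements, the
  homogeneous system with rows \<open>B\<close> would have more unknowns than equations, and a nonzero solution
  would annihilate \<open>S\<close>.
\<close>

lemma span_eq_carrier_if_no_annihilator:
  fixes S :: "'a::field vec set"
  assumes S: "S \<subseteq> carrier_vec n"
    and ann: "\<And>y. y \<in> carrier_vec n \<Longrightarrow> \<forall>s \<in> S. s \<bullet> y = 0 \<Longrightarrow> y = 0\<^sub>v n"
  shows "LinearCombinations.module.span class_ring (module_vec TYPE('a) n) S = carrier_vec n"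
proof -
  interpret vec_space "TYPE('a)" n .
  have li: "finite B \<and> card B \<le> n" if "B \<subseteq> S \<and> lin_indpt B" for B
    using that S li_le_dim[of B] by (auto simp: dim_is_n)
  have "lin_indpt {}"
    by (simp add: lin_dep_def)
  then obtain B where fin: "finite B" and max: "maximal B (\<lambda>B. B \<subseteq> S \<and> lin_indpt B)"
    using maximal_exists[of "\<lambda>B. B \<subseteq> S \<and> lin_indpt B" n "{}"] li by auto
  then have BS: "B \<subseteq> S" and ind: "lin_indpt B"
    by (auto simp: maximal_def)
  have Bc: "B \<subseteq> carrier_vec n"
    using BS S by blast
  have S_span: "S \<subseteq> span B"
  proof (rule ccontr)
    assume "\<not> S \<subseteq> span B"
    then obtain s where s: "s \<in> S" "s \<notin> span B"
      by blast
    have "s \<notin> B"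
      using s in_own_span[OF Bc[folded module_vec_simps(3)]] by blast
    then have "lin_indpt (B \<union> {s})"
      using lin_dep_iff_in_span[of B s] Bc ind s S by auto
    then have "B \<union> {s} = B"
      using max s BS unfolding maximal_def by blast
    then show False
      using \<open>s \<notin> B\<close> by blast
  qed
  have "card B = n"
  proof (rule ccontr)
    assume "card B \<noteq> n"
    then have lt: "card B < n"
      using li[of B] BS ind by auto
    obtain bs where "set bs = B" "distinct bs"
      using finite_distinct_list[OF fin] by blast
    then have bs: "set bs = B" "length bs = card B"
      using distinct_card[of bs] by simp_all
    \<comment> \<open>Padding the rows in \<open>B\<close> with zero rows gives a singular square matrix; a vector in its
      kernel annihilates \<open>B\<close>, hence \<open>S\<close>.\<close>
    define A where "A = mat n n (\<lambda>(i, j). if i < length bs then bs ! i $ j else 0)"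
    have A: "A \<in> carrier_mat n n"
      by (simp add: A_def)
    have "A\<^sup>T *\<^sub>v unit_vec n (n - 1) = 0\<^sub>v n"
      using lt bs by (intro eq_vecI) (auto simp: A_def)
    then have "det A\<^sup>T = 0"
      using A lt by (subst det_0_iff_vec_prod_zero_field[of _ n])
        (auto intro!: exI[of _ "unit_vec n (n - 1)"])
    then have "det A = 0"
      using det_transpose[OF A] by simp
    then obtain y where y: "y \<in> carrier_vec n" "y \<noteq> 0\<^sub>v n" "A *\<^sub>v y = 0\<^sub>v n"
      using det_0_iff_vec_prod_zero_field[OF A] by blast
    have "b \<bullet> y = 0" if b: "b \<in> B" for b
    proof -
      obtain i where i: "i < length bs" "b = bs ! i"
        using b bs by (auto simp: in_set_conv_nth)
      then have "row A i = b"
        using b Bc lt bs by (intro eq_vecI) (auto simp: A_def)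
      moreover have "(A *\<^sub>v y) $ i = 0"
        using y i lt bs by simp
      ultimately show ?thesis
        using i lt bs A by simp
    qed
    then have "\<forall>s \<in> S. s \<bullet> y = 0"
      using in_span_annihilated[OF Bc y(1)] S_span by blast
    then show False
      using ann y by blast
  qed
  then have "basis B"
    using dim_li_is_basis[of B] fin Bc ind by (simp add: dim_is_n)
  then have "span B = carrier_vec n"
    by (simp add: basis_def)
  then show ?thesis
    using span_is_monotone[OF BS] span_is_subset2[of S] S by auto
qed

lemma mult_unit_vec:
  fixes A :: "'a::semiring_1 mat"
  assumes "A \<in> carrier_mat n m" "j < m"
  shows "A *\<^sub>v unit_vec m j = col A j"
  using assms by (intro eq_vecI) auto

text \<open>
  This yields the rank of a matrix with independent rows from the columns that define the rank.
\<close>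

lemma rank_eq_dim_row_if_transpose_kernel_trivial:
  fixes A :: "'a::field mat"
  assumes A: "A \<in> carrier_mat n m"
    and ker: "\<And>y. y \<in> carrier_vec n \<Longrightarrow> A\<^sup>T *\<^sub>v y = 0\<^sub>v m \<Longrightarrow> y = 0\<^sub>v n"
  shows "vec_space.rank n A = n"
proof -
  interpret vec_space "TYPE('a)" n .
  have "span (set (cols A)) = carrier_vec n"
  proof (rule span_eq_carrier_if_no_annihilator)
    show "set (cols A) \<subseteq> carrier_vec n"
      using A cols_dim by blast
  next
    fix y assume y: "y \<in> carrier_vec n" "\<forall>s \<in> set (cols A). s \<bullet> y = 0"
    have "A\<^sup>T *\<^sub>v y = 0\<^sub>v m"
      using A y by (intro eq_vecI) (auto simp: cols_def)
    then show "y = 0\<^sub>v n"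
      using ker y by blast
  qed
  moreover have "vs (carrier_vec n) = V"
    by (simp add: module_vec_def)
  ultimately show ?thesis
    using dim_is_n by (simp only: rank_def)
qed

text \<open>
  Two equal columns would put a difference of two unit vectors into the kernel, so the columns form
  a list without repetitions, and a linear relation between them is a kernel vector.
\<close>

lemma rank_eq_dim_col_if_kernel_trivial:
  fixes A :: "'a::field mat"
  assumes A: "A \<in> carrier_mat n m"
    and ker: "\<And>x. x \<in> carrier_vec m \<Longrightarrow> A *\<^sub>v x = 0\<^sub>v n \<Longrightarrow> x = 0\<^sub>v m"
  shows "vec_space.rank n A = m"
proof -
  interpret vec_space "TYPE('a)" n .
  have dist: "distinct (cols A)"
  proof (rule ccontr)
    assume "\<not> distinct (cols A)"
    then obtain i j where ij: "i < m" "j < m" "i \<noteq> j" "col A i = col A j"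
      using A by (auto simp: distinct_conv_nth)
    have "A *\<^sub>v (unit_vec m i - unit_vec m j) = 0\<^sub>v n"
      using A ij by (simp add: mult_minus_distrib_mat_vec mult_unit_vec)
    then have "unit_vec m i - unit_vec m j = (0\<^sub>v m :: 'a vec)"
      using ker by simp
    then have "(unit_vec m i - unit_vec m j) $ i = (0\<^sub>v m :: 'a vec) $ i"
      by simp
    then show False
      using ij by simp
  qed
  show ?thesis
  proof (rule lin_indpt_full_rank[OF A dist], rule notI)
    assume "lin_dep (set (cols A))"
    then show False
      using ker by (elim lin_depE[OF A _ dist]) blast
  qed
qed

lemma rank_le_urk:
  assumes "V \<subseteq> carrier_mat n p" "M \<in> V"
  shows "vec_space.rank n M \<le> urk n V"
proof -
  have "vec_space.rank n ` V \<subseteq> {..p}"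
    using assms(1) by (auto intro!: vec_space.rank_le_nc)
  then have "finite (vec_space.rank n ` V)"
    by (rule finite_subset) simp
  then show ?thesis
    using assms(2) by (simp add: urk_def)
qed

lemma urk_le:
  assumes "V \<subseteq> carrier_mat n p" "V \<noteq> {}" "\<And>M. M \<in> V \<Longrightarrow> vec_space.rank n M \<le> k"
  shows "urk n V \<le> k"
proof -
  have "vec_space.rank n ` V \<subseteq> {..k}"
    using assms(3) by auto
  then have "finite (vec_space.rank n ` V)"
    by (rule finite_subset) simp
  then show ?thesis
    using assms by (simp add: urk_def)
qed

section \<open>A sufficient condition for primitivity\<close>

text \<open>
  The nonzero \<open>q\<close> represents the hyperplane \<open>{x. q \<bullet> x = 0}\<close>; the condition is that some member of
  \<open>V\<close> is injective on it.
\<close>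

definition hyperplane_injective :: "nat \<Rightarrow> 'a::field mat set \<Rightarrow> bool" where
  "hyperplane_injective p V \<longleftrightarrow>
     (\<forall>q \<in> carrier_vec p. q \<noteq> 0\<^sub>v p \<longrightarrow>
       (\<exists>M \<in> V. \<forall>x \<in> carrier_vec p. x \<in> mat_kernel M \<longrightarrow> q \<bullet> x = 0 \<longrightarrow> x = 0\<^sub>v p))"

lemma invertible_matE:
  assumes "invertible_mat A" "A \<in> carrier_mat n n"
  obtains B where "B \<in> carrier_mat n n" "A * B = 1\<^sub>m n" "B * A = 1\<^sub>m n"
proof -
  obtain B where B: "A * B = 1\<^sub>m (dim_row A)" "B * A = 1\<^sub>m (dim_row B)"
    using assms(1) by (auto simp: invertible_mat_def inverts_mat_def)
  have "dim_row B = n"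
    using arg_cong[OF B(2), of dim_col] assms(2) by simp
  moreover have "dim_col B = n"
    using arg_cong[OF B(1), of dim_col] assms(2) by simp
  ultimately show thesis
    using that[of B] B assms(2) by auto
qed

lemma invertible_mat_transpose:
  fixes A :: "'a::field mat"
  assumes "invertible_mat A" "A \<in> carrier_mat n n"
  shows "invertible_mat A\<^sup>T"
proof -
  obtain B where B: "B \<in> carrier_mat n n" "A * B = 1\<^sub>m n" "B * A = 1\<^sub>m n"
    using invertible_matE[OF assms] .
  have "A\<^sup>T * B\<^sup>T = 1\<^sub>m n" "B\<^sup>T * A\<^sup>T = 1\<^sub>m n"
    using B assms(2) by (metis transpose_mult transpose_one)+
  then show ?thesis
    using B(1) assms(2) by (auto simp: invertible_mat_def inverts_mat_def)
qed

lemma mult_zero_vec: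
  fixes A :: "'a::semiring_1 mat"
  shows "A \<in> carrier_mat n m \<Longrightarrow> A *\<^sub>v 0\<^sub>v m = 0\<^sub>v n"
  by (intro eq_vecI) auto

lemma mult_append_zero:
  fixes A :: "'a::field mat"
  assumes A: "A \<in> carrier_mat n (Suc k)" and u: "u \<in> carrier_vec k"
  shows "A *\<^sub>v (u @\<^sub>v 0\<^sub>v 1) = del_last_col A *\<^sub>v u"
proof (rule eq_vecI)
  fix i assume "i < dim_vec (del_last_col A *\<^sub>v u)"
  then show "(A *\<^sub>v (u @\<^sub>v 0\<^sub>v 1)) $ i = (del_last_col A *\<^sub>v u) $ i"
    using A u by (auto simp: scalar_prod_def del_last_col_def)
qed (use A in \<open>auto simp: del_last_col_def\<close>)

text \<open>
  The kernel of \<open>P M Q\<close> without its last column consists of the \<open>u\<close> for which \<open>Q (u, 0)\<close> lies in the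
  kernel of \<open>M\<close>. The vectors \<open>Q (u, 0)\<close> form the hyperplane whose equation is the last row of
  \<open>Q\<^sup>-\<^sup>1\<close>, so a member \<open>M\<close> that is injective on this hyperplane does the job.
\<close>

lemma hyperplane_injective_del_last_col:
  fixes V :: "'a::field mat set"
  assumes V: "V \<subseteq> carrier_mat n (Suc k)" and hyp: "hyperplane_injective (Suc k) V"
    and P: "P \<in> carrier_mat n n" "invertible_mat P"
    and Q: "Q \<in> carrier_mat (Suc k) (Suc k)" "invertible_mat Q"
  shows "\<exists>M \<in> V. \<forall>u \<in> carrier_vec k. del_last_col (P * M * Q) *\<^sub>v u = 0\<^sub>v n \<longrightarrow> u = 0\<^sub>v k"
proof -
  obtain P' where P': "P' \<in> carrier_mat n n" "P' * P = 1\<^sub>m n"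
    using invertible_matE[OF P(2,1)] .
  obtain Q' where Q': "Q' \<in> carrier_mat (Suc k) (Suc k)" "Q' * Q = 1\<^sub>m (Suc k)"
    using invertible_matE[OF Q(2,1)] .
  \<comment> \<open>This row is nonzero because its product with the last column of \<open>Q\<close> is \<open>1\<close>.\<close>
  let ?q = "row Q' k"
  have "?q \<bullet> col Q k = (Q' * Q) $$ (k, k)"
    using Q(1) Q'(1) by simp
  also have "\<dots> = 1"
    unfolding Q'(2) by simp
  finally have q_col: "?q \<bullet> col Q k = 1" .
  have "?q \<noteq> 0\<^sub>v (Suc k)"
  proof
    assume "?q = 0\<^sub>v (Suc k)"
    moreover have "col Q k \<in> carrier_vec (Suc k)"
      using Q(1) col_dim[of Q k] by simp
    ultimately have "?q \<bullet> col Q k = 0"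
      by (simp only: scalar_prod_left_zero)
    then show False
      using q_col by simp
  qed
  moreover have "?q \<in> carrier_vec (Suc k)"
    using row_carrier[of Q' k] Q'(1) by simp
  ultimately obtain M where M: "M \<in> V"
    and inj: "\<And>x. x \<in> carrier_vec (Suc k) \<Longrightarrow> x \<in> mat_kernel M \<Longrightarrow> ?q \<bullet> x = 0 \<Longrightarrow> x = 0\<^sub>v (Suc k)"
    using hyp unfolding hyperplane_injective_def by blast
  have Mc: "M \<in> carrier_mat n (Suc k)"
    using M V by blast
  have "u = 0\<^sub>v k" if u: "u \<in> carrier_vec k" "del_last_col (P * M * Q) *\<^sub>v u = 0\<^sub>v n" for u
  proof -
    let ?w = "u @\<^sub>v 0\<^sub>v 1"
    have w: "?w \<in> carrier_vec (Suc k)"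
      using append_carrier_vec[OF u(1), of "0\<^sub>v 1" 1] by simp
    let ?x = "Q *\<^sub>v ?w"
    have x: "?x \<in> carrier_vec (Suc k)"
      using Q(1) w by simp
    have "P *\<^sub>v (M *\<^sub>v ?x) = (P * M * Q) *\<^sub>v ?w"
      using P(1) Mc Q(1) w x assoc_mult_mat_vec[of "P * M" n "Suc k" Q "Suc k" ?w]
        assoc_mult_mat_vec[of P n n M "Suc k" ?x] by simp
    also have "\<dots> = 0\<^sub>v n"
      using mult_append_zero[of "P * M * Q" n k u] P(1) Q(1) Mc u by auto
    finally have "P' *\<^sub>v (P *\<^sub>v (M *\<^sub>v ?x)) = 0\<^sub>v n"
      using mult_zero_vec[OF P'(1)] by simp
    then have "M *\<^sub>v ?x = 0\<^sub>v n"
      using P' P(1) Mc x assoc_mult_mat_vec[of P' n n P n "M *\<^sub>v ?x"] by simp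
    then have ker: "?x \<in> mat_kernel M"
      using mat_kernelI[OF Mc x] by simp
    have Q'x: "Q' *\<^sub>v ?x = ?w"
      using Q' Q(1) w assoc_mult_mat_vec[of Q' "Suc k" "Suc k" Q "Suc k" ?w] by simp
    have "?q \<bullet> ?x = (Q' *\<^sub>v ?x) $ k"
      using Q'(1) by simp
    also have "\<dots> = 0"
      unfolding Q'x using u(1) by simp
    finally have "?x = 0\<^sub>v (Suc k)"
      using inj[OF x ker] by simp
    then have w0: "?w = 0\<^sub>v (Suc k)"
      using Q'x mult_zero_vec[OF Q'(1)] by simp
    show ?thesis
    proof (rule eq_vecI)
      fix i assume "i < dim_vec (0\<^sub>v k :: 'a vec)"
      then show "u $ i = 0\<^sub>v k $ i"
        using arg_cong[OF w0, of "\<lambda>v. v $ i"] u(1) by simp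
    qed (use u in auto)
  qed
  then show ?thesis
    using M by blast
qed

lemma urk_del_last_col_ge:
  fixes V :: "'a::field mat set"
  assumes V: "V \<subseteq> carrier_mat n (Suc k)" and hyp: "hyperplane_injective (Suc k) V"
    and eq: "equivalent_spaces n (Suc k) V T"
  shows "k \<le> urk n (del_last_col ` T)"
proof -
  obtain P Q where P: "P \<in> carrier_mat n n" "invertible_mat P"
    and Q: "Q \<in> carrier_mat (Suc k) (Suc k)" "invertible_mat Q"
    and T: "T = (\<lambda>M. P * M * Q) ` V"
    using eq unfolding equivalent_spaces_def by blast
  obtain M where M: "M \<in> V"
    and inj: "\<And>u. u \<in> carrier_vec k \<Longrightarrow> del_last_col (P * M * Q) *\<^sub>v u = 0\<^sub>v n \<Longrightarrow> u = 0\<^sub>v k"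
    using hyperplane_injective_del_last_col[OF V hyp P Q] by blast
  have c: "del_last_col (P * N * Q) \<in> carrier_mat n k" if "N \<in> V" for N
    using P(1) Q(1) by (auto simp: del_last_col_def)
  have "vec_space.rank n (del_last_col (P * M * Q)) = k"
    by (rule rank_eq_dim_col_if_kernel_trivial[OF c[OF M] inj])
  then show ?thesis
    using rank_le_urk[of "del_last_col ` T" n k "del_last_col (P * M * Q)"] c M T by auto
qed

text \<open>
  Deleting the last row of \<open>P M Q\<close> is deleting the last column of its transpose
  \<open>Q\<^sup>T M\<^sup>T P\<^sup>T\<close>, so the statement about kernels applies to the space of transposes.
\<close>

lemma urk_del_last_row_ge:
  fixes V :: "'a::field mat set"
  assumes V: "V \<subseteq> carrier_mat (Suc k) p" and hyp: "hyperplane_injective (Suc k) (transpose_mat ` V)"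
    and eq: "equivalent_spaces (Suc k) p V T"
  shows "k \<le> urk k (del_last_row ` T)"
proof -
  obtain P Q where P: "P \<in> carrier_mat (Suc k) (Suc k)" "invertible_mat P"
    and Q: "Q \<in> carrier_mat p p" "invertible_mat Q"
    and T: "T = (\<lambda>M. P * M * Q) ` V"
    using eq unfolding equivalent_spaces_def by blast
  have Vt: "transpose_mat ` V \<subseteq> carrier_mat p (Suc k)"
    using V by auto
  have Pt: "P\<^sup>T \<in> carrier_mat (Suc k) (Suc k)" "invertible_mat P\<^sup>T"
    and Qt: "Q\<^sup>T \<in> carrier_mat p p" "invertible_mat Q\<^sup>T"
    using P Q invertible_mat_transpose by auto
  obtain M where M: "M \<in> V"
    and inj: "\<And>u. u \<in> carrier_vec k \<Longrightarrow> del_last_col (Q\<^sup>T * M\<^sup>T * P\<^sup>T) *\<^sub>v u = 0\<^sub>v p \<Longrightarrow> u = 0\<^sub>v k"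
    using hyperplane_injective_del_last_col[OF Vt hyp Qt Pt] by blast
  have Mc: "M \<in> carrier_mat (Suc k) p"
    using M V by blast
  have "Q\<^sup>T * M\<^sup>T * P\<^sup>T = (P * M * Q)\<^sup>T"
    using P(1) Q(1) Mc
      transpose_mult[of "P * M" "Suc k" p Q p] transpose_mult[of P "Suc k" "Suc k" M p]
    by (simp add: assoc_mult_mat[of _ p p _ "Suc k" _ "Suc k"])
  moreover have "del_last_col N\<^sup>T = (del_last_row N)\<^sup>T" for N :: "'a mat"
    by (auto simp: del_last_col_def del_last_row_def)
  ultimately have D: "del_last_col (Q\<^sup>T * M\<^sup>T * P\<^sup>T) = (del_last_row (P * M * Q))\<^sup>T"
    by simp
  have c: "del_last_row (P * N * Q) \<in> carrier_mat k p" if "N \<in> V" for N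
    using P(1) Q(1) by (auto simp: del_last_row_def)
  have "vec_space.rank k (del_last_row (P * M * Q)) = k"
    by (rule rank_eq_dim_row_if_transpose_kernel_trivial[OF c[OF M]]) (use inj D in simp)
  then show ?thesis
    using rank_le_urk[of "del_last_row ` T" k p "del_last_row (P * M * Q)"] c M T by auto
qed

text \<open>
  In dimension at least \<open>2\<close> every vector lies in some hyperplane, on which a member of \<open>V\<close> is
  injective.
\<close>

lemma hyperplane_injective_no_common_kernel:
  fixes V :: "'a::field mat set"
  assumes hyp: "hyperplane_injective p V" and p: "2 \<le> p"
    and x: "x \<in> carrier_vec p" "\<forall>M \<in> V. x \<in> mat_kernel M"
  shows "x = 0\<^sub>v p"
proof -
  obtain q where q: "q \<in> carrier_vec p" "q \<noteq> 0\<^sub>v p" "q \<bullet> x = 0"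
  proof (cases "x $ 0 = 0")
    case True
    have "unit_vec p 0 \<noteq> (0\<^sub>v p :: 'a vec)"
      using p by simp
    then show thesis
      using that[of "unit_vec p 0"] True x p by simp
  next
    case False
    let ?q = "x $ 1 \<cdot>\<^sub>v unit_vec p 0 - x $ 0 \<cdot>\<^sub>v unit_vec p 1"
    have "?q $ 1 \<noteq> 0"
      using False p by simp
    then have "?q \<noteq> 0\<^sub>v p"
      using p by (auto dest: arg_cong[where f = "\<lambda>v. v $ 1"])
    moreover have "?q \<bullet> x = 0"
      using x p by (simp add: minus_scalar_prod_distrib[where n = p])
    ultimately show thesis
      using that[of ?q] by simp
  qed
  then show ?thesis
    using hyp x unfolding hyperplane_injective_def by blast
qed

lemma equivalent_spaces_refl:
  fixes V :: "'a::field mat set"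
  assumes "V \<subseteq> carrier_mat n p"
  shows "equivalent_spaces n p V V"
proof -
  have inv: "invertible_mat (1\<^sub>m m :: 'a mat)" for m
    by (auto simp: invertible_mat_def inverts_mat_def intro!: exI[of _ "1\<^sub>m m"])
  have "1\<^sub>m n * M * 1\<^sub>m p = M" if "M \<in> V" for M
    using that assms by (metis left_mult_one_mat right_mult_one_mat subsetD)
  then have "V = (\<lambda>M. 1\<^sub>m n * M * 1\<^sub>m p) ` V"
    by simp
  then show ?thesis
    unfolding equivalent_spaces_def using inv one_carrier_mat by blast
qed

text \<open>
  A vector orthogonal to the ranges of all matrices is a common kernel vector of the transposes;
  hence the condition on the ranges is the transposed form of the one on the kernels.
\<close>

lemma primitive_space_if_hyperplane_injective:
  fixes V :: "'a::field mat set"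
  assumes sub: "linear_subspace n n V" and n: "2 \<le> n" and urk: "urk n V \<le> n - 1"
    and col: "hyperplane_injective n V" and row: "hyperplane_injective n (transpose_mat ` V)"
  shows "primitive_space n n V"
proof -
  have V: "V \<subseteq> carrier_mat n n"
    using sub by (auto simp: linear_subspace_def subspace_def submodule_def module_mat_simps)
  obtain k where k: "n = Suc k"
    using n by (cases n) auto
  have "LinearCombinations.module.span class_ring (module_vec TYPE('a) n) (\<Union>M \<in> V. mat_range M)
      = carrier_vec n"
  proof (rule span_eq_carrier_if_no_annihilator)
    show "(\<Union>M \<in> V. mat_range M) \<subseteq> carrier_vec n"
      using V by (auto simp: mat_range_def)
  next
    fix y :: "'a vec"
    assume y: "y \<in> carrier_vec n" and ann: "\<forall>s \<in> (\<Union>M \<in> V. mat_range M). s \<bullet> y = 0"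
    have "y \<in> mat_kernel M\<^sup>T" if "M \<in> V" for M
    proof (rule mat_kernelI)
      have M: "M \<in> carrier_mat n n"
        using that V by blast
      show "M\<^sup>T *\<^sub>v y = 0\<^sub>v n"
      proof (rule eq_vecI)
        fix j assume "j < dim_vec (0\<^sub>v n :: 'a vec)"
        then have j: "j < n"
          by simp
        have "col M j = M *\<^sub>v unit_vec n j"
          using M j by (simp add: mult_unit_vec)
        then have "col M j \<in> mat_range M"
          using M by (auto simp: mat_range_def)
        then show "(M\<^sup>T *\<^sub>v y) $ j = 0\<^sub>v n $ j"
          using ann that M j by auto
      qed (use M in auto)
      show "M\<^sup>T \<in> carrier_mat n n"
        using M by simp
    qed (rule y)
    then show "y = 0\<^sub>v n"
      using hyperplane_injective_no_common_kernel[OF row n y] by blast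
  qed
  moreover have "\<not> urk n (del_last_col ` T) < urk n V" if "equivalent_spaces n n V T" for T
    using urk_del_last_col_ge[of V n k T] V col that urk by (simp add: k)
  moreover have "\<not> urk (n - 1) (del_last_row ` T) < urk n V" if "equivalent_spaces n n V T" for T
    using urk_del_last_row_ge[of V k n T] V row that urk by (simp add: k)
  ultimately show ?thesis
    using sub hyperplane_injective_no_common_kernel[OF col n]
    unfolding primitive_space_def by blast
qed

section \<open>The space of trace-zero upper-triangular matrices\<close>

lemma tri_mat_carrier [simp]: "tri_mat a b c d e \<in> carrier_mat 3 3"
  by (simp add: tri_mat_def mat_of_rows_list_def numeral_3_eq_3 del: add_bit_eq_xor)

lemma J3_carrier: "J3 \<subseteq> carrier_mat 3 3"
  by (auto simp: J3_def)

lemma tri_mat_in_J3: "tri_mat a b c d e \<in> J3"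
  unfolding J3_def by blast

lemma tri_mat_dims [simp]: "dim_row (tri_mat a b c d e) = 3" "dim_col (tri_mat a b c d e) = 3"
  using tri_mat_carrier by blast+

lemma tri_mat_index:
  "tri_mat a b c d e $$ (0, 0) = a" "tri_mat a b c d e $$ (0, 1) = c" "tri_mat a b c d e $$ (0, 2) = d"
  "tri_mat a b c d e $$ (1, 0) = 0" "tri_mat a b c d e $$ (1, 1) = a + b" "tri_mat a b c d e $$ (1, 2) = e"
  "tri_mat a b c d e $$ (2, 0) = 0" "tri_mat a b c d e $$ (2, 1) = 0" "tri_mat a b c d e $$ (2, 2) = b"
  by (simp_all add: tri_mat_def mat_of_rows_list_def del: add_bit_eq_xor)

text \<open>
  Simplification rewrites the indices \<open>1\<close> and \<open>2\<close> to successor form in some contexts, so the rules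
  are needed for both forms.
\<close>

lemmas tri_mat_entries [simp] =
  tri_mat_index tri_mat_index[unfolded One_nat_def] tri_mat_index[unfolded One_nat_def numeral_2_eq_2]

lemma less_3_cases: "i < 3 \<longleftrightarrow> i = 0 \<or> i = 1 \<or> i = (2 :: nat)"
  by auto

lemma vec_3_eq_0_iff:
  "v \<in> carrier_vec 3 \<Longrightarrow> v = 0\<^sub>v 3 \<longleftrightarrow> v $ 0 = 0 \<and> v $ 1 = 0 \<and> v $ 2 = 0"
  by (auto simp: vec_eq_iff less_3_cases)

lemma scalar_prod_3:
  fixes v w :: "'a::comm_ring_1 vec"
  shows "w \<in> carrier_vec 3 \<Longrightarrow> v \<bullet> w = v $ 0 * w $ 0 + v $ 1 * w $ 1 + v $ 2 * w $ 2"
  by (auto simp: scalar_prod_def eval_nat_numeral)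

lemma tri_mat_kernel_iff:
  assumes "x \<in> carrier_vec 3"
  shows "x \<in> mat_kernel (tri_mat a b c d e) \<longleftrightarrow>
    a * x $ 0 + c * x $ 1 + d * x $ 2 = 0 \<and> (a + b) * x $ 1 + e * x $ 2 = 0 \<and> b * x $ 2 = 0"
proof -
  have "x \<in> mat_kernel (tri_mat a b c d e) \<longleftrightarrow> tri_mat a b c d e *\<^sub>v x = 0\<^sub>v 3"
    using assms by (simp add: mat_kernel_def)
  also have "\<dots> \<longleftrightarrow> (\<forall>i \<in> {0, 1, 2}. (tri_mat a b c d e *\<^sub>v x) $ i = 0)"
    by (subst vec_3_eq_0_iff) (use assms in \<open>auto intro!: mult_mat_vec_carrier\<close>)
  finally show ?thesis
    using assms by (simp add: scalar_prod_3 del: add_bit_eq_xor mult_bit_eq_and)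
qed

lemma tri_mat_transpose_kernel_iff:
  assumes "y \<in> carrier_vec 3"
  shows "y \<in> mat_kernel (tri_mat a b c d e)\<^sup>T \<longleftrightarrow>
    a * y $ 0 = 0 \<and> c * y $ 0 + (a + b) * y $ 1 = 0 \<and> d * y $ 0 + e * y $ 1 + b * y $ 2 = 0"
proof -
  have "y \<in> mat_kernel (tri_mat a b c d e)\<^sup>T \<longleftrightarrow> (tri_mat a b c d e)\<^sup>T *\<^sub>v y = 0\<^sub>v 3"
    using assms by (simp add: mat_kernel_def)
  also have "\<dots> \<longleftrightarrow> (\<forall>i \<in> {0, 1, 2}. ((tri_mat a b c d e)\<^sup>T *\<^sub>v y) $ i = 0)"
    by (subst vec_3_eq_0_iff) (use assms in \<open>auto intro!: mult_mat_vec_carrier\<close>)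
  finally show ?thesis
    using assms by (simp add: scalar_prod_3 del: add_bit_eq_xor mult_bit_eq_and)
qed

lemma add_tri_mat:
  "tri_mat a b c d e + tri_mat a' b' c' d' e' = tri_mat (a + a') (b + b') (c + c') (d + d') (e + e')"
  by (rule eq_matI) (auto simp: less_3_cases ac_simps
      simp del: add_bit_eq_xor)

lemma smult_tri_mat:
  "k \<cdot>\<^sub>m tri_mat a b c d e = tri_mat (k * a) (k * b) (k * c) (k * d) (k * e)"
  by (rule eq_matI) (auto simp: less_3_cases distrib_left
      simp del: add_bit_eq_xor mult_bit_eq_and)

lemma zero_eq_tri_mat: "0\<^sub>m 3 3 = tri_mat 0 0 0 0 0"
  by (rule eq_matI) (auto simp: less_3_cases)

lemma linear_subspace_J3: "linear_subspace 3 3 J3"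
  unfolding linear_subspace_def
proof (intro subspace.intro submodule.intro)
  show vs: "vectorspace class_ring (module_mat TYPE(bit) 3 3)"
    by (rule matrix_vs)
  then show "module class_ring (module_mat TYPE(bit) 3 3)"
    by (simp add: vectorspace_def)
next
  show "J3 \<subseteq> carrier (module_mat TYPE(bit) 3 3)"
    using J3_carrier by (simp add: module_mat_simps)
  show "\<zero>\<^bsub>module_mat TYPE(bit) 3 3\<^esub> \<in> J3"
    by (simp add: module_mat_simps zero_eq_tri_mat tri_mat_in_J3)
next
  fix v w assume "v \<in> J3" "w \<in> J3"
  then obtain a b c d e a' b' c' d' e' where "v = tri_mat a b c d e" "w = tri_mat a' b' c' d' e'"
    unfolding J3_def by blast
  then show "v \<oplus>\<^bsub>module_mat TYPE(bit) 3 3\<^esub> w \<in> J3"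
    by (simp only: module_mat_simps add_tri_mat tri_mat_in_J3)
next
  fix k v assume "v \<in> J3"
  then obtain a b c d e where "v = tri_mat a b c d e"
    unfolding J3_def by blast
  then show "k \<odot>\<^bsub>module_mat TYPE(bit) 3 3\<^esub> v \<in> J3"
    by (simp only: module_mat_simps smult_tri_mat tri_mat_in_J3)
qed

lemma linear_subspaceD:
  assumes "linear_subspace n p V"
  shows "0\<^sub>m n p \<in> V" "\<And>A B. A \<in> V \<Longrightarrow> B \<in> V \<Longrightarrow> A + B \<in> V"
  using assms by (auto simp: linear_subspace_def subspace_def submodule_def module_mat_simps)

lemma bit_mult_add_mult: "a * b * (a + b) = (0 :: bit)"
  by (cases a; cases b) auto

lemma upper_triangular_tri_mat: "upper_triangular (tri_mat a b c d e)"
  unfolding upper_triangular_def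
  by (auto simp: less_3_cases less_2_cases_iff)

lemma rank_tri_mat_le: "vec_space.rank 3 (tri_mat a b c d e) \<le> 2"
proof -
  have "det (tri_mat a b c d e) = a * (a + b) * b"
    by (subst det_upper_triangular[OF upper_triangular_tri_mat tri_mat_carrier])
      (simp add: diag_mat_def eval_nat_numeral del: add_bit_eq_xor mult_bit_eq_and)
  also have "\<dots> = 0"
    using bit_mult_add_mult[of a b] by (simp only: ac_simps)
  finally have "vec_space.rank 3 (tri_mat a b c d e) \<noteq> 3"
    using vec_space.det_rank_iff[OF tri_mat_carrier] by blast
  then show ?thesis
    using vec_space.rank_le_nc[OF tri_mat_carrier, of a b c d e] by linarith
qed

text \<open>
  Changing the last diagonal entry from \<open>0\<close> to \<open>1\<close> makes the matrix invertible, and a change of one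
  entry alters the rank by at most \<open>1\<close>.
\<close>

lemma rank_tri_mat_1_0: "2 \<le> vec_space.rank 3 (tri_mat 1 0 c d e)"
proof -
  define E :: "bit mat" where "E = mat 3 3 (\<lambda>(i, j). if i = 2 \<and> j = 2 then 1 else 0)"
  let ?M = "tri_mat 1 0 c d e"
  have E: "E \<in> carrier_mat 3 3"
    by (simp add: E_def)
  have "upper_triangular (?M + E)"
    by (auto simp: upper_triangular_def less_3_cases less_2_cases_iff E_def)
  then have "det (?M + E) = 1"
    by (subst det_upper_triangular[where n = 3])
      (use E in \<open>auto simp: diag_mat_def E_def eval_nat_numeral\<close>)
  then have "vec_space.rank 3 (?M + E) = 3"
    using vec_space.det_rank_iff[of "?M + E" 3] E by auto
  moreover have "vec_space.rank 3 E \<le> 1"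
    by (rule vec_space.rank_le_1_product_entries[OF E,
          of "\<lambda>i. if i = 2 then 1 else 0" "\<lambda>j. if j = 2 then 1 else 0"]) (simp add: E_def)
  ultimately show ?thesis
    using vec_space.rank_subadditive[OF tri_mat_carrier E, of 1 0 c d e] by linarith
qed

text \<open>
  The diagonals \<open>(0, 1, 1)\<close>, \<open>(1, 0, 1)\<close>, \<open>(1, 1, 0)\<close> give kernels spanned by \<open>(1, 0, 0)\<close>,
  \<open>(?, 1, 0)\<close>, \<open>(?, ?, 1)\<close>. On the kernel of the matrix chosen according to the first nonzero
  coordinate of \<open>q\<close>, the functional \<open>q\<close> does not vanish.
\<close>

lemma hyperplane_injective_if_all_diagonals:
  assumes diag: "\<forall>a b. \<exists>c d e. tri_mat a b c d e \<in> W"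
  shows "hyperplane_injective 3 W"
  unfolding hyperplane_injective_def
proof (intro ballI impI)
  fix q :: "bit vec"
  assume q: "q \<in> carrier_vec 3" "q \<noteq> 0\<^sub>v 3"
  consider "q $ 0 = 1" | "q $ 0 = 0" "q $ 1 = 1" | "q $ 0 = 0" "q $ 1 = 0" "q $ 2 = 1"
    using q vec_3_eq_0_iff[of q] by fastforce
  then obtain a b where ab: "\<And>c d e x. x \<in> carrier_vec 3 \<Longrightarrow> x \<in> mat_kernel (tri_mat a b c d e) \<Longrightarrow>
      q \<bullet> x = 0 \<Longrightarrow> x = 0\<^sub>v 3"
  proof cases
    case 1
    show thesis
      by (rule that[of 0 1])
        (use 1 in \<open>auto simp: tri_mat_kernel_iff vec_3_eq_0_iff scalar_prod_3\<close>)
  next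
    case 2
    show thesis
      by (rule that[of 1 1])
        (use 2 in \<open>auto simp: tri_mat_kernel_iff vec_3_eq_0_iff scalar_prod_3\<close>)
  next
    case 3
    show thesis
      by (rule that[of 1 0])
        (use 3 in \<open>auto simp: tri_mat_kernel_iff vec_3_eq_0_iff scalar_prod_3\<close>)
  qed
  then show "\<exists>M \<in> W. \<forall>x \<in> carrier_vec 3. x \<in> mat_kernel M \<longrightarrow> q \<bullet> x = 0 \<longrightarrow> x = 0\<^sub>v 3"
    using diag by meson
qed

text \<open>
  The left kernels are spanned by \<open>(0, 0, 1)\<close>, \<open>(0, 1, ?)\<close>, \<open>(1, ?, ?)\<close> for the diagonals
  \<open>(1, 1, 0)\<close>, \<open>(1, 0, 1)\<close>, \<open>(0, 1, 1)\<close>, so here the last nonzero coordinate of \<open>q\<close> decides.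
\<close>

lemma hyperplane_injective_transpose_if_all_diagonals:
  assumes diag: "\<forall>a b. \<exists>c d e. tri_mat a b c d e \<in> W"
  shows "hyperplane_injective 3 (transpose_mat ` W)"
  unfolding hyperplane_injective_def
proof (intro ballI impI)
  fix q :: "bit vec"
  assume q: "q \<in> carrier_vec 3" "q \<noteq> 0\<^sub>v 3"
  consider "q $ 2 = 1" | "q $ 2 = 0" "q $ 1 = 1" | "q $ 2 = 0" "q $ 1 = 0" "q $ 0 = 1"
    using q vec_3_eq_0_iff[of q] by fastforce
  then obtain a b where ab: "\<And>c d e x. x \<in> carrier_vec 3 \<Longrightarrow> x \<in> mat_kernel (tri_mat a b c d e)\<^sup>T \<Longrightarrow>
      q \<bullet> x = 0 \<Longrightarrow> x = 0\<^sub>v 3"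
  proof cases
    case 1
    show thesis
      by (rule that[of 1 0])
        (use 1 in \<open>auto simp: tri_mat_transpose_kernel_iff vec_3_eq_0_iff scalar_prod_3\<close>)
  next
    case 2
    show thesis
      by (rule that[of 1 1])
        (use 2 in \<open>auto simp: tri_mat_transpose_kernel_iff vec_3_eq_0_iff scalar_prod_3\<close>)
  next
    case 3
    show thesis
      by (rule that[of 0 1])
        (use 3 in \<open>auto simp: tri_mat_transpose_kernel_iff vec_3_eq_0_iff scalar_prod_3\<close>)
  qed
  then show "\<exists>M \<in> transpose_mat ` W. \<forall>x \<in> carrier_vec 3. x \<in> mat_kernel M \<longrightarrow> q \<bullet> x = 0 \<longrightarrow> x = 0\<^sub>v 3"
    using diag by (meson imageI)
qed

lemma primitive_if_all_diagonals:
  assumes W: "linear_subspace 3 3 W" "W \<subseteq> J3"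
    and diag: "\<forall>a b. \<exists>c d e. tri_mat a b c d e \<in> W"
  shows "primitive_space 3 3 W \<and> urk 3 W = 2"
proof -
  have Wc: "W \<subseteq> carrier_mat 3 3"
    using W(2) J3_carrier by blast
  obtain c d e where M: "tri_mat 1 0 c d e \<in> W"
    using diag by blast
  have "vec_space.rank 3 M \<le> 2" if "M \<in> W" for M
    using that W(2) rank_tri_mat_le by (auto simp: J3_def)
  then have "urk 3 W \<le> 2"
    using M by (intro urk_le[OF Wc]) auto
  moreover have "2 \<le> urk 3 W"
    using rank_tri_mat_1_0 rank_le_urk[OF Wc M] order_trans by blast
  ultimately have urk: "urk 3 W = 2"
    by simp
  then have "primitive_space 3 3 W"
    using W(1) diag hyperplane_injective_if_all_diagonals
      hyperplane_injective_transpose_if_all_diagonals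
    by (intro primitive_space_if_hyperplane_injective) auto
  then show ?thesis
    using urk by blast
qed

text \<open>
  The set \<open>D\<close> of the pairs \<open>(a, b)\<close> that occur is closed under addition. Primitivity provides an
  element of \<open>D\<close> outside each of the lines \<open>a = 0\<close>, \<open>b = 0\<close> and \<open>a = b\<close>, and no proper subspace of
  the plane over the field with two elements has this property.
\<close>

lemma all_diagonals_if_primitive:
  assumes W: "linear_subspace 3 3 W" "W \<subseteq> J3"
    and prim: "primitive_space 3 3 W" and urk: "urk 3 W = 2"
  shows "\<exists>c d e. tri_mat a b c d e \<in> W"
proof -
  define D where "D = {(a, b). \<exists>c d e. tri_mat a b c d e \<in> W}"
  have zero: "(0, 0) \<in> D"
    using linear_subspaceD(1)[OF W(1)] by (auto simp: D_def zero_eq_tri_mat)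
  have add: "(a + a', b + b') \<in> D" if "(a, b) \<in> D" "(a', b') \<in> D" for a b a' b'
    using that linear_subspaceD(2)[OF W(1)] unfolding D_def
    by (auto simp only: add_tri_mat case_prod_conv mem_Collect_eq) (metis add_tri_mat)
  have W_D: "\<exists>a b c d e. M = tri_mat a b c d e \<and> (a, b) \<in> D" if "M \<in> W" for M
    using that W(2) by (fastforce simp: D_def J3_def)
  have Wc: "W \<subseteq> carrier_mat 3 3"
    using W(2) J3_carrier by blast
  \<comment> \<open>Otherwise the first unit vector is a common kernel vector.\<close>
  have "\<exists>b. (1, b) \<in> D"
  proof (rule ccontr)
    assume neg: "\<not> ?thesis"
    have "unit_vec 3 0 \<in> mat_kernel M" if "M \<in> W" for M
    proof -
      obtain a b c d e where M: "M = tri_mat a b c d e" and "(a, b) \<in> D"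
        using W_D[OF \<open>M \<in> W\<close>] by blast
      then have "a = 0"
        using neg by (cases a) auto
      then show ?thesis
        by (simp add: M tri_mat_kernel_iff)
    qed
    moreover have "unit_vec 3 0 \<noteq> (0\<^sub>v 3 :: bit vec)"
      by simp
    ultimately show False
      using prim unit_vec_carrier unfolding primitive_space_def by blast
  qed
  then obtain b1 where b1: "(1, b1) \<in> D"
    by blast
  \<comment> \<open>Otherwise all ranges lie in the plane orthogonal to the last unit vector.\<close>
  have "\<exists>a. (a, 1) \<in> D"
  proof (rule ccontr)
    let ?y = "unit_vec 3 2 :: bit vec" and ?R = "\<Union>M \<in> W. mat_range M"
    assume neg: "\<not> ?thesis"
    have "s \<bullet> ?y = 0" if s: "s \<in> ?R" for s
    proof -
      obtain M x where M: "M \<in> W" and x: "x \<in> carrier_vec (dim_col M)" and sx: "s = M *\<^sub>v x"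
        using s unfolding mat_range_def by blast
      obtain a b c d e where Mt: "M = tri_mat a b c d e" and "(a, b) \<in> D"
        using W_D[OF M] by blast
      then have "b = 0"
        using neg by (cases b) auto
      then have "(M *\<^sub>v x) $ 2 = 0"
        using x by (simp add: Mt scalar_prod_3)
      moreover have "s \<bullet> ?y = s $ 2"
        using sx by (simp add: Mt scalar_prod_right_unit)
      ultimately show ?thesis
        using sx by simp
    qed
    moreover have "?R \<subseteq> carrier_vec 3"
      using Wc unfolding mat_range_def by (auto intro!: mult_mat_vec_carrier)
    moreover have "?y \<in> LinearCombinations.module.span class_ring (module_vec TYPE(bit) 3) ?R"
      using prim unit_vec_carrier unfolding primitive_space_def by blast
    ultimately have "?y \<bullet> ?y = 0"
      using in_span_annihilated[of ?R 3 ?y ?y] unit_vec_carrier by blast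
    then show False
      by simp
  qed
  then obtain a1 where a1: "(a1, 1) \<in> D"
    by blast
  \<comment> \<open>Otherwise the middle diagonal entry is always zero, and without the last column only the first
    row survives.\<close>
  have "(1, 0) \<in> D \<or> (0, 1) \<in> D"
  proof (rule ccontr)
    assume neg: "\<not> ?thesis"
    have "vec_space.rank 3 (del_last_col M) \<le> 1" if "M \<in> W" for M
    proof -
      obtain a b c d e where M: "M = tri_mat a b c d e" and "(a, b) \<in> D"
        using W_D[OF \<open>M \<in> W\<close>] by blast
      then have ab: "a + b = 0"
        using neg by (cases a; cases b) auto
      have "del_last_col M \<in> carrier_mat 3 2"
        by (simp add: M del_last_col_def)
      then show ?thesis
      proof (rule vec_space.rank_le_1_product_entries)
        fix i j assume "i < dim_row (del_last_col M)" "j < dim_col (del_last_col M)"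
        then have "i < 3" "j < 2"
          by (simp_all add: M del_last_col_def)
        then show "del_last_col M $$ (i, j) = (if i = 0 then 1 else 0) * M $$ (0, j)"
          using ab by (auto simp: M del_last_col_def less_3_cases less_2_cases_iff
              simp del: add_bit_eq_xor)
      qed
    qed
    moreover have "del_last_col ` W \<subseteq> carrier_mat 3 2"
      using Wc by (auto simp: del_last_col_def)
    moreover have "W \<noteq> {}"
      using linear_subspaceD(1)[OF W(1)] by blast
    ultimately have "urk 3 (del_last_col ` W) \<le> 1"
      by (intro urk_le) auto
    then show False
      using prim urk equivalent_spaces_refl[OF Wc] unfolding primitive_space_def by auto
  qed
  then have "(1, 0) \<in> D \<and> (0, 1) \<in> D"
  proof
    assume "(1, 0) \<in> D"
    then show ?thesis
      using a1 add[of a1 1 1 0] by (cases a1) auto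
  next
    assume "(0, 1) \<in> D"
    then show ?thesis
      using b1 add[of 1 b1 0 1] by (cases b1) auto
  qed
  then have "(a, b) \<in> D"
    using zero add[of 1 0 0 1] by (cases a; cases b) auto
  then show ?thesis
    by (simp add: D_def)
qed

theorem proposition1p4:
  shows "primitive_space 3 3 J3 \<and> urk 3 J3 = 2 \<and>
    (\<forall>W. linear_subspace 3 3 W \<and> W \<subseteq> J3 \<longrightarrow>
      (primitive_space 3 3 W \<and> urk 3 W = 2 \<longleftrightarrow>
       (\<forall>a b. \<exists>c d e. tri_mat a b c d e \<in> W)))"
proof (intro conjI allI impI)
  have "\<forall>a b. \<exists>c d e. tri_mat a b c d e \<in> J3"
    using tri_mat_in_J3 by blast
  then have "primitive_space 3 3 J3 \<and> urk 3 J3 = 2"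
    by (intro primitive_if_all_diagonals linear_subspace_J3) auto
  then show "primitive_space 3 3 J3" "urk 3 J3 = 2"
    by blast+
next
  fix W assume "linear_subspace 3 3 W \<and> W \<subseteq> J3"
  then show "primitive_space 3 3 W \<and> urk 3 W = 2 \<longleftrightarrow> (\<forall>a b. \<exists>c d e. tri_mat a b c d e \<in> W)"
    using primitive_if_all_diagonals all_diagonals_if_primitive by blast
qed

end
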